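(* Let $\boldsymbol{A}\in\mathbb{R}^{n\times d}$ be nonzero with $n>d$, let $\boldsymbol{b}\in\mathbb{R}^n$, let $\mu\in(0,1)$, let $\lambda=\frac{1-\mu}{\mu}\|\boldsymbol{A}\|_{\rm F}^2$, and let $$\boldsymbol{x}_\mu=\operatorname*{argmin}_{\boldsymbol{x}\in\mathbb{R}^d}\bigl[\|\boldsymbol{b}-\boldsymbol{A}\boldsymbol{x}\|^2+\lambda\|\boldsymbol{x}\|^2\bigr].$$ Let $\kappa_{\rm dem}=\|\boldsymbol{A}^+\|\,\|\boldsymbol{A}\|_{\rm F}$. Let $\boldsymbol{x}_0\in\operatorname{range}(\boldsymbol{A}^\top)$, let $0\le t_{\rm b}<t$ be integers, let $\boldsymbol{x}_0,\boldsymbol{x}_1,\ldots$ be the iterates of randomized Kaczmarz for ridge regression (RK-RR) with parameter $\mu$ started at $\boldsymbol{x}_0$, and let $$\overline{\boldsymbol{x}}_t=\frac{1}{t-t_{\rm b}}\sum_{s=t_{\rm b}}^{t-1}\boldsymbol{x}_s$$ be their tail average (the TARK-RR output). Then $$\mathbb{E}\,\|\overline{\boldsymbol{x}}_t-\boldsymbol{x}_\mu\|^2\le 2\,\bigl[\mu^2(1-\kappa_{\rm dem}^{-2})\bigr]^{t_{\rm b}}\,\|\boldsymbol{x}_0-\boldsymbol{x}_\mu\|^2+\frac{2\mu}{(t-t_{\rm b})(1-\mu)\lambda}\,\|\boldsymbol{b}-\boldsymbol{A}\boldsymbol{x}_\mu\|^2 .$$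
   Context: $\|\cdot\|$ is the $\ell_2$ norm of a vector or the spectral norm of a matrix, $\|\cdot\|_{\rm F}$ is the Frobenius norm, and $\boldsymbol{A}^+$ is the Moore–Penrose pseudoinverse. $\boldsymbol{a}_i^\top$ is the $i$th row of $\boldsymbol{A}$ and $b_i$ the $i$th entry of $\boldsymbol{b}$. The RK-RR iteration with parameter $\mu\in(0,1)$, started at a fixed (deterministic) $\boldsymbol{x}_0$, is: for $t=0,1,2,\ldots$, independently sample an index $i_t\in\{1,\ldots,n\}$ with $\mathbb{P}\{i_t=i\}=\|\boldsymbol{a}_i\|^2/\|\boldsymbol{A}\|_{\rm F}^2$ (so zero rows are never selected, almost surely) and set $$\boldsymbol{x}_{t+1/2}=\boldsymbol{x}_t+\frac{b_{i_t}-\boldsymbol{a}_{i_t}^\top\boldsymbol{x}_t}{\|\boldsymbol{a}_{i_t}\|^2}\,\boldsymbol{a}_{i_t},\qquad \boldsymbol{x}_{t+1}=\mu\,\boldsymbol{x}_{t+1/2}.$$ The expectation is over the random indices. The convention $0^0=1$ is used. *)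

theory Defs
  imports "HOL-Probability.Probability"
begin

definition spectral_norm :: "real^'d^'n \<Rightarrow> real" where
  "spectral_norm A = onorm (\<lambda>x. A *v x)"

definition frobenius_norm :: "real^'d^'n \<Rightarrow> real" where
  "frobenius_norm A = sqrt (\<Sum>i\<in>UNIV. \<Sum>j\<in>UNIV. (A $ i $ j)\<^sup>2)"

definition is_moore_penrose :: "real^'d^'n \<Rightarrow> real^'n^'d \<Rightarrow> bool" where
  "is_moore_penrose A P \<longleftrightarrow>
     A ** P ** A = A \<and> P ** A ** P = P \<and>
     transpose (A ** P) = A ** P \<and> transpose (P ** A) = P ** A"

definition pseudoinverse :: "real^'d^'n \<Rightarrow> real^'n^'d" where
  "pseudoinverse A = (THE P. is_moore_penrose A P)"

definition demmel_cond :: "real^'d^'n \<Rightarrow> real" where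
  "demmel_cond A = spectral_norm (pseudoinverse A) * frobenius_norm A"

definition ridge_solution :: "real^'d^'n \<Rightarrow> real^'n \<Rightarrow> real \<Rightarrow> real^'d" where
  "ridge_solution A b l =
     arg_min (\<lambda>x. (norm (b - A *v x))\<^sup>2 + l * (norm x)\<^sup>2) (\<lambda>x. True)"

(* For a zero row the quotient is 0 in HOL, so the step is the identity; such rows are
   selected with probability 0. *)
definition kaczmarz_step :: "real^'d^'n \<Rightarrow> real^'n \<Rightarrow> 'n \<Rightarrow> real^'d \<Rightarrow> real^'d" where
  "kaczmarz_step A b i x =
     x + ((b $ i - row i A \<bullet> x) / (norm (row i A))\<^sup>2) *\<^sub>R row i A"

(* The iterates are a deterministic function of the index sequence; randomness
   enters only through the choice of that sequence. *)
primrec rk_rr :: "real^'d^'n \<Rightarrow> real^'n \<Rightarrow> real \<Rightarrow> real^'d \<Rightarrow> (nat \<Rightarrow> 'n) \<Rightarrow> nat \<Rightarrow> real^'d" where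
  "rk_rr A b \<mu> x0 idx 0 = x0"
| "rk_rr A b \<mu> x0 idx (Suc t) = \<mu> *\<^sub>R kaczmarz_step A b (idx t) (rk_rr A b \<mu> x0 idx t)"

definition tail_average :: "(nat \<Rightarrow> real^'d) \<Rightarrow> nat \<Rightarrow> nat \<Rightarrow> real^'d" where
  "tail_average x tb t = (1 / real (t - tb)) *\<^sub>R (\<Sum>s = tb..<t. x s)"

definition kaczmarz_sampling :: "real^'d^'n \<Rightarrow> 'w measure \<Rightarrow> (nat \<Rightarrow> 'w \<Rightarrow> 'n) \<Rightarrow> bool" where
  "kaczmarz_sampling A M I \<longleftrightarrow>
     prob_space M \<and>
     prob_space.indep_vars M (\<lambda>_. count_space UNIV) I UNIV \<and>
     (\<forall>t i. measure M {\<omega> \<in> space M. I t \<omega> = i} = (norm (row i A))\<^sup>2 / (frobenius_norm A)\<^sup>2)"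

end

theory Submission
  imports Defs
begin

text \<open>The error \<open>e\<^sub>s = x\<^sub>s - x\<^sub>\<mu>\<close> obeys \<open>e\<^sub>s\<^sub>+\<^sub>1 = \<mu> P\<^sub>i e\<^sub>s + w\<^sub>i\<close>, where \<open>P\<^sub>i\<close> projects onto the hyperplane
  orthogonal to the sampled row; the normal equations of ridge regression say exactly that the
  noise \<open>w\<^sub>i\<close> has mean zero. By linearity \<open>e = u + v\<close>, where \<open>u\<close> starts at \<open>e\<^sub>0\<close> and sees no noise and
  \<open>v\<close> starts at 0. The second moment of \<open>u\<close> contracts by \<open>\<mu>\<^sup>2 (1 - \<kappa>\<^sup>-\<^sup>2)\<close> per step because \<open>u\<close> stays in
  the row space. Since \<open>E v = 0\<close>, the cross terms in the second moment of \<open>v\<close> vanish, so it is at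
  most \<open>E |w|\<^sup>2 / (1 - \<mu>\<^sup>2)\<close>, and since the conditional mean of a step shrinks norms by \<open>\<mu>\<close>, the
  correlation of \<open>v\<^sub>s\<close> and \<open>v\<^sub>s\<^sub>+\<^sub>k\<close> decays like \<open>\<mu>\<^sup>k\<close>, whence averaging gains the factor \<open>1 / (t - t\<^sub>b)\<close>.\<close>

subsection \<open>The pseudoinverse and the ridge solution\<close>

lemma inner_matrix_transpose:
  fixes A :: "real^'d^'n"
  shows "(A *v x) \<bullet> y = x \<bullet> (transpose A *v y)"
  by (metis dot_lmul_matrix inner_commute vector_transpose_matrix)

text \<open>Pairing the hypothesis with \<open>y\<close> gives the squared norm of
  \<open>transpose A *v y\<close>. Thus the kernel of \<open>A\<close> meets the row space only in
  0.\<close>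

lemma transpose_matrix_mul_cancel:
  fixes A :: "real^'d^'n"
  assumes "A *v (transpose A *v y) = 0"
  shows "transpose A *v y = 0"
proof -
  have "(transpose A *v y) \<bullet> (transpose A *v y) = (A *v (transpose A *v y)) \<bullet> y"
    by (simp add: inner_matrix_transpose)
  with assms show ?thesis by simp
qed

lemma subspace_row_space: "subspace (range (\<lambda>y. transpose (A :: real^'d^'n) *v y))"
  by (intro linear_subspace_image subspace_UNIV matrix_vector_mul_linear)

text \<open>\<open>A\<close> is injective on its row space, so some linear map undoes it there.
  Since row-space vectors are exactly the \<open>transpose A *v y\<close>, this becomes a matrix
  identity.\<close>

lemma left_inverse_on_row_space:
  fixes A :: "real^'d^'n"
  obtains G :: "real^'n^'d" where "G ** A ** transpose A = transpose A"
proof -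
  let ?V = "range (\<lambda>y. transpose A *v y)"
  note sub = subspace_row_space[of A]
  have "inj_on (\<lambda>x. A *v x) ?V"
  proof (rule inj_onI)
    fix x y assume "x \<in> ?V" "y \<in> ?V" and eq: "A *v x = A *v y"
    then have "x - y \<in> ?V" using sub by (rule_tac subspace_diff)
    then obtain z where z: "x - y = transpose A *v z" by blast
    have "A *v (x - y) = 0" using eq by (simp add: matrix_vector_mult_diff_distrib)
    then have "x - y = 0" unfolding z by (rule transpose_matrix_mul_cancel)
    then show "x = y" by simp
  qed
  from linear_exists_left_inverse_on[OF matrix_vector_mul_linear sub this]
  obtain g where g: "linear g" "\<And>v. v \<in> ?V \<Longrightarrow> g (A *v v) = v"
    by blast
  have "(matrix g ** A ** transpose A) *v y = transpose A *v y" for y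
    using g(2)[of "transpose A *v y"] by (simp add: matrix_vector_mul_assoc[symmetric] matrix_works g(1))
  then show thesis using that by (metis matrix_eq)
qed

text \<open>\<open>A ** P\<close> and \<open>A ** Q\<close> are both the orthogonal projection onto
  the column space, \<open>P ** A\<close> and \<open>Q ** A\<close> both that onto the row space.
  Each equality follows because transposing a product of symmetric factors swaps them.\<close>

lemma is_moore_penrose_unique:
  assumes "is_moore_penrose A P" "is_moore_penrose A Q"
  shows "P = Q"
proof -
  note p = assms(1)[unfolded is_moore_penrose_def] and q = assms(2)[unfolded is_moore_penrose_def]
  have 1: "A ** P = A ** Q"
  proof -
    have "A ** P = (A ** Q) ** (A ** P)" using q by (metis matrix_mul_assoc)
    then have "transpose (A ** P) = transpose (A ** P) ** transpose (A ** Q)"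
      by (metis matrix_transpose_mul)
    then have "A ** P = (A ** P) ** (A ** Q)" using p q by simp
    then show ?thesis using p by (metis matrix_mul_assoc)
  qed
  have 2: "P ** A = Q ** A"
  proof -
    have "P ** A = (P ** A) ** (Q ** A)" using q by (metis matrix_mul_assoc)
    then have "transpose (P ** A) = transpose (Q ** A) ** transpose (P ** A)"
      by (metis matrix_transpose_mul)
    then have "P ** A = (Q ** A) ** (P ** A)" using p q by simp
    then show ?thesis using p by (metis matrix_mul_assoc)
  qed
  have "P = P ** (A ** P)" using p by (simp add: matrix_mul_assoc)
  also have "\<dots> = P ** A ** Q" by (simp add: 1 matrix_mul_assoc)
  also have "\<dots> = Q" using q by (simp add: 2)
  finally show ?thesis .
qed

text \<open>With \<open>G\<close> inverting \<open>A\<close> on its row space and \<open>H\<close> inverting \<open>A\<^sup>T\<close> on its row space,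
  the pseudoinverse is \<open>G A H\<^sup>T\<close>.\<close>
lemma is_moore_penrose_pseudoinverse:
  fixes A :: "real^'d^'n"
  shows "is_moore_penrose A (pseudoinverse A)"
proof -
  obtain G where G: "G ** A ** transpose A = transpose A"
    by (rule left_inverse_on_row_space)
  obtain H where "H ** transpose A ** transpose (transpose A) = transpose (transpose A)"
    by (rule left_inverse_on_row_space)
  then have H: "H ** transpose A ** A = A" by simp
  \<comment> \<open>With \<open>X = B ** C\<close> the premise gives
    \<open>X ** transpose X = transpose X\<close>; the left side is symmetric, hence so is
    \<open>X\<close>. Applied to \<open>A\<close> with \<open>G\<close> and to
    \<open>transpose A\<close> with \<open>H\<close>.\<close>
  have symm: "transpose (B ** C) = B ** C \<and> C ** B ** C = C" if "B ** C ** transpose C = transpose C"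
    for B :: "real^'p^'q" and C :: "real^'q^'p"
  proof -
    have "(B ** C) ** transpose (B ** C) = transpose (B ** C)"
      using that by (metis matrix_mul_assoc matrix_transpose_mul)
    then have s: "transpose (B ** C) = B ** C"
      by (metis matrix_transpose_mul transpose_transpose)
    have "transpose (B ** C ** transpose C) = C" using that by simp
    then have "C ** transpose (B ** C) = C" by (simp add: matrix_transpose_mul)
    then show ?thesis using s by (simp add: matrix_mul_assoc)
  qed
  \<comment> \<open>Transposed, \<open>H\<close> acts on the right of \<open>A\<close>: then
    \<open>A ** K\<close> is symmetric and \<open>A ** K ** A = A\<close>, mirroring what
    \<open>G\<close> does on the left.\<close>
  define K where "K = transpose H"
  have GA: "transpose (G ** A) = G ** A" "A ** G ** A = A" using symm[OF G] by auto
  have "transpose (H ** transpose A) = H ** transpose A" using symm[of H "transpose A"] H by simp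
  then have AK: "transpose (A ** K) = A ** K" by (simp add: K_def matrix_transpose_mul)
  have "A ** K = H ** transpose A" using AK by (simp add: K_def matrix_transpose_mul)
  then have AKA: "A ** K ** A = A" using H by simp
  let ?P = "G ** A ** K"
  have e: "A ** ?P = A ** K" "?P ** A = G ** A" using GA(2) AKA by (metis matrix_mul_assoc)+
  have "is_moore_penrose A ?P"
    unfolding is_moore_penrose_def e using GA AK AKA by (metis e matrix_mul_assoc)
  then show ?thesis unfolding pseudoinverse_def
    by (rule theI) (use \<open>is_moore_penrose A ?P\<close> is_moore_penrose_unique in blast)
qed

lemma norm_matrix_vector_mult_le: "norm (A *v x) \<le> spectral_norm A * norm x"
  unfolding spectral_norm_def by (rule onorm) (simp add: matrix_vector_mul_bounded_linear)

text \<open>\<open>pseudoinverse A ** A\<close> is the orthogonal projection onto the row space: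
  transposing \<open>A = A ** (pseudoinverse A ** A)\<close> and using its symmetry shows that it
  fixes every \<open>transpose A *v y\<close>.\<close>

lemma norm_row_space_le:
  fixes A :: "real^'d^'n"
  assumes "x \<in> range (\<lambda>y. transpose A *v y)"
  shows "norm x \<le> spectral_norm (pseudoinverse A) * norm (A *v x)"
proof -
  note mp = is_moore_penrose_pseudoinverse[of A, unfolded is_moore_penrose_def]
  obtain y where y: "x = transpose A *v y" using assms by blast
  have "pseudoinverse A ** A ** transpose A = transpose (pseudoinverse A ** A) ** transpose A"
    using mp by simp
  also have "\<dots> = transpose (A ** (pseudoinverse A ** A))" by (simp only: matrix_transpose_mul)
  also have "\<dots> = transpose A" using mp by (simp add: matrix_mul_assoc)
  finally have "pseudoinverse A ** A ** transpose A = transpose A" .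
  then have eq: "pseudoinverse A *v (A *v x) = x"
    unfolding y by (metis matrix_vector_mul_assoc)
  show ?thesis using norm_matrix_vector_mult_le[of "pseudoinverse A" "A *v x"] unfolding eq .
qed

section \<open>Row norms, the Frobenius norm and the condition number\<close>

lemma row_inner_eq: "row i A \<bullet> x = (A *v x) $ i"
  by (simp add: row_def matrix_vector_mult_def inner_vec_def)

lemma power2_norm_vec: "(norm (x :: real^'n))\<^sup>2 = (\<Sum>i\<in>UNIV. (x $ i)\<^sup>2)"
  by (simp add: norm_vec_def L2_set_def sum_nonneg)

lemma frobenius_norm_sq: "(frobenius_norm A)\<^sup>2 = (\<Sum>i\<in>UNIV. (norm (row i A))\<^sup>2)"
  unfolding frobenius_norm_def
  by (subst real_sqrt_pow2) (auto intro!: sum_nonneg sum.cong simp: power2_norm_vec row_def)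

lemma frobenius_norm_pos:
  assumes "A \<noteq> 0"
  shows "0 < frobenius_norm A"
proof -
  obtain i j where "A $ i $ j \<noteq> 0" using assms by (metis vec_eq_iff zero_index)
  then have "0 < (\<Sum>j\<in>UNIV. (A $ i $ j)\<^sup>2)" by (intro sum_pos2[of _ j]) auto
  then have "0 < (\<Sum>i\<in>UNIV. \<Sum>j\<in>UNIV. (A $ i $ j)\<^sup>2)"
    by (intro sum_pos2[of _ i]) (auto intro: sum_nonneg)
  then show ?thesis by (simp add: frobenius_norm_def)
qed

lemma norm_matrix_vector_mult_le_frobenius: "norm (A *v x) \<le> frobenius_norm A * norm x"
proof (rule power2_le_imp_le)
  have "(norm (A *v x))\<^sup>2 \<le> (\<Sum>i\<in>UNIV. (norm (row i A) * norm x)\<^sup>2)"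
    unfolding power2_norm_vec[of "A *v x"] row_inner_eq[symmetric]
    by (intro sum_mono) (metis Cauchy_Schwarz_ineq2 power2_abs power_mono abs_ge_zero)
  also have "\<dots> = (frobenius_norm A * norm x)\<^sup>2"
    by (simp add: frobenius_norm_sq power_mult_distrib sum_distrib_right)
  finally show "(norm (A *v x))\<^sup>2 \<le> (frobenius_norm A * norm x)\<^sup>2" .
  show "0 \<le> frobenius_norm A * norm x" by (simp add: frobenius_norm_def sum_nonneg)
qed

text \<open>The right side is the mean loss of squared norm under a random row projection; this
  bounds it below by a fixed fraction of the squared norm.\<close>

lemma norm_sq_row_space_le:
  fixes A :: "real^'d^'n"
  assumes "A \<noteq> 0" "x \<in> range (\<lambda>y. transpose A *v y)"
  shows "(norm x)\<^sup>2 / (demmel_cond A)\<^sup>2 \<le> (norm (A *v x))\<^sup>2 / (frobenius_norm A)\<^sup>2"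
\<comment> \<open>If the condition number is 0, division by zero makes the left side 0.\<close>
proof (cases "demmel_cond A = 0")
  case False
  have f: "frobenius_norm A > 0" by (rule frobenius_norm_pos[OF assms(1)])
  have "(norm x)\<^sup>2 \<le> (spectral_norm (pseudoinverse A) * norm (A *v x))\<^sup>2"
    using norm_row_space_le[OF assms(2)] by (intro power_mono) auto
  then show ?thesis using False f
    by (simp add: demmel_cond_def field_simps power_mult_distrib)
qed simp

text \<open>Any nonzero row-space vector, sent through \<open>A\<close> and back, cannot gain more
  than the product of the two norms. This keeps the contraction factor nonnegative.\<close>

lemma demmel_cond_ge_1:
  fixes A :: "real^'d^'n"
  assumes "A \<noteq> 0"
  shows "1 \<le> demmel_cond A"
proof -
  have "\<exists>y. transpose A *v y \<noteq> 0"
  proof (rule ccontr)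
    assume "\<nexists>y. transpose A *v y \<noteq> 0"
    then have "transpose A = 0" unfolding matrix_eq by simp
    then show False using assms by (simp add: transpose_def vec_eq_iff)
  qed
  then obtain x where x: "x \<in> range (\<lambda>y. transpose A *v y)" "x \<noteq> 0" by blast
  have "norm x \<le> spectral_norm (pseudoinverse A) * norm (A *v x)"
    by (rule norm_row_space_le[OF x(1)])
  also have "\<dots> \<le> spectral_norm (pseudoinverse A) * (frobenius_norm A * norm x)"
    by (intro mult_left_mono norm_matrix_vector_mult_le_frobenius)
       (simp add: spectral_norm_def onorm_pos_le matrix_vector_mul_bounded_linear)
  finally show ?thesis using x(2) by (simp add: demmel_cond_def mult.assoc[symmetric])
qed

text \<open>The ridge solution is given by choice, so existence and uniqueness of a minimizer must
  be shown. Positive definiteness of \<open>?B\<close> makes the normal equation solvable, and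
  expanding the objective around a solution \<open>z\<close> shows that \<open>z\<close> is the only
  minimizer.\<close>

lemma ridge_normal_equation:
  fixes A :: "real^'d^'n"
  assumes "0 < l"
  shows "transpose A *v (b - A *v ridge_solution A b l) = l *\<^sub>R ridge_solution A b l"
proof -
  let ?f = "\<lambda>x. (norm (b - A *v x))\<^sup>2 + l * (norm x)\<^sup>2"
  let ?B = "\<lambda>x. transpose A *v (A *v x) + l *\<^sub>R x"
  have lin: "linear ?B"
    by (intro linear_compose_add linear_compose_scale_right linear_id[unfolded id_def]
        linear_compose[OF matrix_vector_mul_linear matrix_vector_mul_linear, unfolded o_def])
  have "inj ?B"
  proof (rule linear_injective_0[OF lin, THEN iffD2], intro allI impI)
    fix x assume "?B x = 0"
    then have "0 = x \<bullet> ?B x" by simp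
    also have "\<dots> = (norm (A *v x))\<^sup>2 + l * (norm x)\<^sup>2"
      by (simp only: inner_add_right inner_matrix_transpose[symmetric] power2_norm_eq_inner inner_scaleR_right)
    finally have "l * (norm x)\<^sup>2 \<le> 0" by (smt (verit) zero_le_power2)
    then show "x = 0" using assms by (simp add: mult_le_0_iff)
  qed
  then obtain z where "?B z = transpose A *v b"
    using linear_injective_imp_surjective[OF lin] by (blast dest: surjD[of _ "transpose A *v b"] intro: sym)
  then have z: "transpose A *v (b - A *v z) = l *\<^sub>R z"
    by (simp add: matrix_vector_mult_diff_distrib algebra_simps)
  \<comment> \<open>The linear terms of the residual and of the penalty are opposite by the normal
    equation for \<open>z\<close>, so only squares remain.\<close>
  have expand: "?f x = ?f z + (norm (A *v (x - z)))\<^sup>2 + l * (norm (x - z))\<^sup>2" for x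
  proof -
    have 1: "b - A *v x = (b - A *v z) - A *v (x - z)" by (simp add: matrix_vector_mult_diff_distrib)
    have "(A *v (x - z)) \<bullet> (b - A *v z) = l * ((x - z) \<bullet> z)"
      unfolding inner_matrix_transpose z by simp
    moreover have "(norm (b - A *v x))\<^sup>2
        = (norm (b - A *v z))\<^sup>2 - 2 * ((A *v (x - z)) \<bullet> (b - A *v z)) + (norm (A *v (x - z)))\<^sup>2"
      unfolding 1 by (simp only: power2_norm_eq_inner inner_diff_left inner_diff_right inner_commute) simp
    moreover have "(norm x)\<^sup>2 = (norm z)\<^sup>2 + 2 * ((x - z) \<bullet> z) + (norm (x - z))\<^sup>2"
      by (simp add: power2_norm_eq_inner inner_diff_left inner_diff_right inner_commute)
    ultimately show ?thesis by (simp only: distrib_left mult.left_commute[of l 2])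
  qed
  have min: "?f z \<le> ?f x" for x
    unfolding expand[of x] using assms by simp
  then have "is_arg_min ?f (\<lambda>_. True) z" by (simp only: is_arg_min_linorder) blast
  \<comment> \<open>Choice returns some minimizer; by the expansion its value exceeds that of
    \<open>z\<close> unless the two points agree.\<close>
  then have "is_arg_min ?f (\<lambda>_. True) (ridge_solution A b l)"
    unfolding ridge_solution_def arg_min_def by (rule someI)
  then have "?f (ridge_solution A b l) \<le> ?f z" by (simp only: is_arg_min_linorder)
  then have "l * (norm (ridge_solution A b l - z))\<^sup>2 \<le> 0"
    unfolding expand[of "ridge_solution A b l"] using zero_le_power2[of "norm (A *v (ridge_solution A b l - z))"] by linarith
  then have "ridge_solution A b l = z" using assms by (simp add: mult_le_0_iff)
  then show ?thesis using z by simp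
qed

subsection \<open>Functions of finitely many sampled indices\<close>

text \<open>A pointwise form of measurability with respect to the indices \<open>0\<close>, ...,
  \<open>s - 1\<close>. Over a finite index type such a function takes finitely many values.\<close>

definition depends_below :: "nat \<Rightarrow> ((nat \<Rightarrow> 'i) \<Rightarrow> 'a) \<Rightarrow> bool" where
  "depends_below s f \<longleftrightarrow> (\<forall>idx idx'. (\<forall>r<s. idx r = idx' r) \<longrightarrow> f idx = f idx')"

lemma depends_below_mono: "depends_below s f \<Longrightarrow> s \<le> s' \<Longrightarrow> depends_below s' f"
  unfolding depends_below_def by (meson less_le_trans)

lemma depends_below_const: "depends_below s (\<lambda>_. c)"
  by (simp add: depends_below_def)

lemma depends_below_comp: "depends_below s f \<Longrightarrow> depends_below s (\<lambda>idx. h (f idx))"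
  unfolding depends_below_def by metis

lemma depends_below_comp2:
  "depends_below s f \<Longrightarrow> depends_below s g \<Longrightarrow> depends_below s (\<lambda>idx. h (f idx) (g idx))"
  unfolding depends_below_def by metis

locale index_sampling = prob_space M for M :: "'w measure" +
  fixes I :: "nat \<Rightarrow> 'w \<Rightarrow> 'n::finite" and p :: "'n \<Rightarrow> real"
  assumes indep: "indep_vars (\<lambda>_. count_space UNIV) I UNIV"
    and prob_index: "measure M {\<omega> \<in> space M. I s \<omega> = i} = p i"
begin

text \<open>Taking functions of the whole index sequence as arguments lets the deterministic
  recursions be unfolded under the expectation.\<close>

definition expect :: "((nat \<Rightarrow> 'n) \<Rightarrow> real) \<Rightarrow> real" where
  "expect f = expectation (\<lambda>\<omega>. f (\<lambda>r. I r \<omega>))"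

lemma measurable_I: "I s \<in> measurable M (count_space UNIV)"
  using indep by (simp add: indep_vars_def)

text \<open>A finite product of finite discrete spaces is discrete, so every function on it is
  measurable.\<close>

lemma measurable_on_prefix:
  fixes f :: "(nat \<Rightarrow> 'n) \<Rightarrow> real"
  shows "f \<in> borel_measurable (PiM {..<s} (\<lambda>_. count_space UNIV))"
proof -
  have "PiM {..<s} (\<lambda>_. count_space (UNIV :: 'n set)) = count_space (PiE {..<s} (\<lambda>_. UNIV))"
    by (rule count_space_PiM_finite) (simp_all add: countable_finite)
  then show ?thesis by simp
qed

lemma depends_below_restrict:
  "depends_below s f \<Longrightarrow> f (restrict idx {..<s}) = f idx"
  by (auto simp: depends_below_def)

lemma measurable_prefix:
  fixes f :: "(nat \<Rightarrow> 'n) \<Rightarrow> real"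
  assumes "depends_below s f"
  shows "(\<lambda>\<omega>. f (\<lambda>r. I r \<omega>)) \<in> borel_measurable M"
proof -
  have "(\<lambda>\<omega>. restrict (\<lambda>r. I r \<omega>) {..<s}) \<in> measurable M (PiM {..<s} (\<lambda>_. count_space UNIV))"
    by (intro measurable_restrict measurable_I)
  from measurable_compose[OF this measurable_on_prefix[of f]]
  show ?thesis by (simp add: depends_below_restrict[OF assms])
qed

text \<open>There are finitely many prefixes of length \<open>s\<close>, so \<open>f\<close> is
  bounded by its maximum over them.\<close>

lemma integrable_prefix:
  fixes f :: "(nat \<Rightarrow> 'n) \<Rightarrow> real"
  assumes "depends_below s f"
  shows "integrable M (\<lambda>\<omega>. f (\<lambda>r. I r \<omega>))"
proof (rule integrable_const_bound)
  have fin: "finite (f ` (PiE {..<s} (\<lambda>_. UNIV)))"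
    by (intro finite_imageI finite_PiE) auto
  have "norm (f idx) \<le> Max (norm ` f ` (PiE {..<s} (\<lambda>_. UNIV)))" for idx
    by (subst depends_below_restrict[OF assms, symmetric], rule Max_ge) (use fin in auto)
  then show "AE \<omega> in M. norm (f (\<lambda>r. I r \<omega>)) \<le> Max (norm ` f ` (PiE {..<s} (\<lambda>_. UNIV)))"
    by simp
qed (rule measurable_prefix[OF assms])

lemma expect_add:
  "depends_below s f \<Longrightarrow> depends_below s g \<Longrightarrow> expect (\<lambda>idx. f idx + g idx) = expect f + expect g"
  unfolding expect_def by (intro Bochner_Integration.integral_add integrable_prefix)

lemma expect_cmult: "expect (\<lambda>idx. c * f idx) = c * expect f"
  unfolding expect_def by simp

lemma expect_const: "expect (\<lambda>idx. c) = c"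
  unfolding expect_def by (simp add: prob_space)

lemma expect_sum:
  "(\<And>j. j \<in> J \<Longrightarrow> depends_below s (f j)) \<Longrightarrow> expect (\<lambda>idx. \<Sum>j\<in>J. f j idx) = (\<Sum>j\<in>J. expect (f j))"
  unfolding expect_def by (intro Bochner_Integration.integral_sum integrable_prefix)

lemma expect_mono:
  assumes "depends_below s f" "depends_below s g" "\<And>idx. f idx \<le> g idx"
  shows "expect f \<le> expect g"
  unfolding expect_def
  by (rule integral_mono[OF integrable_prefix[OF assms(1)] integrable_prefix[OF assms(2)] assms(3)])

lemma p_nonneg: "0 \<le> p i"
  by (metis prob_index measure_nonneg)

lemma sum_p: "(\<Sum>i\<in>UNIV. p i) = 1"
proof -
  have "(\<Sum>i\<in>UNIV. p i) = measure M (\<Union>i\<in>UNIV. {\<omega> \<in> space M. I 0 \<omega> = i})"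
    unfolding prob_index[of 0, symmetric]
    by (rule finite_measure_finite_Union[symmetric])
       (use measurable_I[of 0] in \<open>auto simp: disjoint_family_on_def\<close>)
  also have "(\<Union>i\<in>UNIV. {\<omega> \<in> space M. I 0 \<omega> = i}) = space M" by auto
  finally show ?thesis by (simp add: prob_space)
qed

text \<open>Conditioning on the first \<open>s\<close> indices, in elementary form: index number
  \<open>s\<close> is independent of them and may be averaged out while they are frozen.\<close>

lemma expect_fresh_index:
  assumes g: "\<And>i. depends_below s (g i)"
  shows "expect (\<lambda>idx. g (idx s) idx) = expect (\<lambda>idx. \<Sum>i\<in>UNIV. p i * g i idx)"
proof -
  let ?N = "\<lambda>_::nat. count_space (UNIV :: 'n set)"
  let ?h = "\<lambda>i j. if j = i then 1 else 0 :: real"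
  have ind: "indep_var (PiM {..<s} ?N) (\<lambda>\<omega>. restrict (\<lambda>r. I r \<omega>) {..<s})
                 (PiM {s} ?N) (\<lambda>\<omega>. restrict (\<lambda>r. I r \<omega>) {s})"
    by (rule indep_var_restrict[OF indep]) auto
  have dep: "depends_below (Suc s) (\<lambda>idx. ?h i (idx s))"
    "depends_below (Suc s) (\<lambda>idx. g i idx * ?h i (idx s))" for i
    using depends_below_mono[OF g, of "Suc s" i] by (auto simp: depends_below_def)
  \<comment> \<open>The two factors are functions of the disjoint index blocks \<open>{..<s}\<close>
    and \<open>{s}\<close>, hence independent.\<close>
  have "expect (\<lambda>idx. g i idx * ?h i (idx s)) = expect (g i) * expect (\<lambda>idx. ?h i (idx s))" for i
  proof -
    have "indep_var borel (g i \<circ> (\<lambda>\<omega>. restrict (\<lambda>r. I r \<omega>) {..<s}))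
             borel ((\<lambda>f. ?h i (f s)) \<circ> (\<lambda>\<omega>. restrict (\<lambda>r. I r \<omega>) {s}))"
      by (rule indep_var_compose[OF ind measurable_on_prefix], subst count_space_PiM_finite) auto
    then have "indep_var borel (\<lambda>\<omega>. g i (\<lambda>r. I r \<omega>)) borel (\<lambda>\<omega>. ?h i (I s \<omega>))"
      by (simp add: o_def depends_below_restrict[OF g])
    then show ?thesis unfolding expect_def
      by (rule indep_var_lebesgue_integral) (rule integrable_prefix[OF g], rule integrable_prefix[OF dep(1)])
  qed
  moreover have "expect (\<lambda>idx. ?h i (idx s)) = p i" for i
  proof -
    have "expect (\<lambda>idx. ?h i (idx s)) = expectation (indicator {\<omega> \<in> space M. I s \<omega> = i})"
      unfolding expect_def by (intro Bochner_Integration.integral_cong) (auto simp: indicator_def)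
    also have "\<dots> = prob ({\<omega> \<in> space M. I s \<omega> = i} \<inter> space M)"
      by simp
    also have "\<dots> = p i"
      using prob_index[of s i] by (simp add: Int_def conj_commute)
    finally show ?thesis .
  qed
  ultimately have *: "expect (\<lambda>idx. g i idx * ?h i (idx s)) = p i * expect (g i)" for i
    by simp
  \<comment> \<open>Partition by the value of the fresh index: exactly one indicator
    \<open>?h i (idx s)\<close> equals 1.\<close>
  have "expect (\<lambda>idx. g (idx s) idx) = expect (\<lambda>idx. \<Sum>i\<in>UNIV. g i idx * ?h i (idx s))"
    by (intro arg_cong[of _ _ expect] ext) (simp add: mult_delta_right)
  also have "\<dots> = (\<Sum>i\<in>UNIV. p i * expect (g i))"
    by (subst expect_sum[OF dep(2)]) (simp_all only: *)
  also have "\<dots> = expect (\<lambda>idx. \<Sum>i\<in>UNIV. p i * g i idx)"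
    by (subst expect_sum[of _ s]) (auto intro: g depends_below_comp simp: expect_cmult)
  finally show ?thesis .
qed

end

subsection \<open>Random symmetric contractions with additive noise\<close>

text \<open>One index drives both the contraction and the noise of a step, so within a step the two
  may be correlated.\<close>

primrec affine_iterate ::
  "('i \<Rightarrow> 'v::real_vector \<Rightarrow> 'v) \<Rightarrow> real \<Rightarrow> ('i \<Rightarrow> 'v) \<Rightarrow> 'v \<Rightarrow> (nat \<Rightarrow> 'i) \<Rightarrow> nat \<Rightarrow> 'v" where
  "affine_iterate P \<mu> w z idx 0 = z"
| "affine_iterate P \<mu> w z idx (Suc s) = \<mu> *\<^sub>R P (idx s) (affine_iterate P \<mu> w z idx s) + w (idx s)"

lemma affine_iterate_split:
  assumes "\<And>i. linear (P i)"
  shows "affine_iterate P \<mu> w z idx s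
    = affine_iterate P \<mu> (\<lambda>_. 0) z idx s + affine_iterate P \<mu> w 0 idx s"
  by (induction s) (simp_all add: linear_add[OF assms] scaleR_add_right)

lemma depends_below_affine_iterate: "depends_below s (\<lambda>idx. affine_iterate P \<mu> w z idx s)"
proof (induction s)
  case (Suc s)
  then show ?case unfolding depends_below_def by (metis affine_iterate.simps(2) less_Suc_eq)
qed (simp add: depends_below_def)

text \<open>Abstracts from row projections. Symmetry is what moves a step of the iterate onto the
  other argument of an inner product.\<close>

locale symmetric_contractions = index_sampling M I p
  for M :: "'w measure" and I :: "nat \<Rightarrow> 'w \<Rightarrow> 'n::finite" and p :: "'n \<Rightarrow> real" +
  fixes P :: "'n \<Rightarrow> 'v::real_inner \<Rightarrow> 'v" and \<mu> :: real
  assumes linear_P: "linear (P i)"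
    and symmetric_P: "P i x \<bullet> y = x \<bullet> P i y"
    and contraction_P: "norm (P i x) \<le> norm x"
    and mu_nonneg: "0 \<le> \<mu>" and mu_less_1: "\<mu> < 1"
begin

lemma expect_norm_sq_homogeneous:
  assumes S: "subspace S" "\<And>i x. x \<in> S \<Longrightarrow> P i x \<in> S" and z: "z \<in> S"
    and decay: "\<And>x. x \<in> S \<Longrightarrow> (\<Sum>i\<in>UNIV. p i * (norm (P i x))\<^sup>2) \<le> q * (norm x)\<^sup>2"
    and q: "0 \<le> q"
  shows "expect (\<lambda>idx. (norm (affine_iterate P \<mu> (\<lambda>_. 0) z idx s))\<^sup>2) \<le> (\<mu>\<^sup>2 * q) ^ s * (norm z)\<^sup>2"
proof (induction s)
  case 0
  then show ?case by (simp add: expect_const)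
next
  case (Suc s)
  let ?u = "\<lambda>idx. affine_iterate P \<mu> (\<lambda>_. 0) z idx"
  \<comment> \<open>Invariance of \<open>S\<close> makes the decay bound, assumed on
    \<open>S\<close> alone, available at every step.\<close>
  have in_S: "?u idx s \<in> S" for idx
    by (induction s) (simp_all add: z S(2) subspace_scale[OF S(1)])
  note dep = depends_below_affine_iterate[of s P \<mu> "\<lambda>_. 0" z]
  have "expect (\<lambda>idx. (norm (?u idx (Suc s)))\<^sup>2)
      = expect (\<lambda>idx. (norm (\<mu> *\<^sub>R P (idx s) (?u idx s)))\<^sup>2)"
    by simp
  also have "\<dots> = expect (\<lambda>idx. \<Sum>i\<in>UNIV. p i * (norm (\<mu> *\<^sub>R P i (?u idx s)))\<^sup>2)"
    by (rule expect_fresh_index[of s "\<lambda>i idx. (norm (\<mu> *\<^sub>R P i (?u idx s)))\<^sup>2"])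
       (rule depends_below_comp[OF dep])
  also have "\<dots> \<le> expect (\<lambda>idx. (\<mu>\<^sup>2 * q) * (norm (?u idx s))\<^sup>2)"
  proof (rule expect_mono[of s])
    fix idx
    have "(\<Sum>i\<in>UNIV. p i * (norm (\<mu> *\<^sub>R P i (?u idx s)))\<^sup>2)
        = \<mu>\<^sup>2 * (\<Sum>i\<in>UNIV. p i * (norm (P i (?u idx s)))\<^sup>2)"
      by (simp add: power_mult_distrib sum_distrib_left mult.left_commute)
    also have "\<dots> \<le> \<mu>\<^sup>2 * (q * (norm (?u idx s))\<^sup>2)"
      by (intro mult_left_mono decay in_S) simp
    finally show "(\<Sum>i\<in>UNIV. p i * (norm (\<mu> *\<^sub>R P i (?u idx s)))\<^sup>2) \<le> (\<mu>\<^sup>2 * q) * (norm (?u idx s))\<^sup>2"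
      by (simp add: mult.assoc)
  qed (rule depends_below_comp[OF dep])+
  also have "\<dots> = (\<mu>\<^sup>2 * q) * expect (\<lambda>idx. (norm (?u idx s))\<^sup>2)"
    by (rule expect_cmult)
  also have "\<dots> \<le> (\<mu>\<^sup>2 * q) * ((\<mu>\<^sup>2 * q) ^ s * (norm z)\<^sup>2)"
    by (intro mult_left_mono Suc) (simp add: q)
  finally show ?case by (simp add: mult.assoc)
qed

text \<open>The conditional mean of one noiseless step from \<open>x\<close>.\<close>

definition mean_map :: "'v \<Rightarrow> 'v" where
  "mean_map x = \<mu> *\<^sub>R (\<Sum>i\<in>UNIV. p i *\<^sub>R P i x)"

lemma norm_mean_map: "norm (mean_map x) \<le> \<mu> * norm x"
proof -
  have "norm (\<Sum>i\<in>UNIV. p i *\<^sub>R P i x) \<le> (\<Sum>i\<in>UNIV. p i * norm x)"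
    by (rule sum_norm_le) (simp add: p_nonneg mult_left_mono contraction_P)
  also have "\<dots> = norm x" by (simp add: sum_distrib_right[symmetric] sum_p)
  finally show ?thesis using mu_nonneg by (simp add: mean_map_def mult_left_mono)
qed

lemma norm_mean_map_power: "norm ((mean_map ^^ k) x) \<le> \<mu> ^ k * norm x"
proof (induction k)
  case (Suc k)
  have "norm ((mean_map ^^ Suc k) x) \<le> \<mu> * norm ((mean_map ^^ k) x)"
    by (simp add: norm_mean_map)
  also have "\<dots> \<le> \<mu> * (\<mu> ^ k * norm x)" by (intro mult_left_mono Suc mu_nonneg)
  finally show ?case by (simp add: mult.assoc)
qed simp

section \<open>The noise part started at 0: mean, correlations and window sums\<close>

context
  fixes w :: "'n \<Rightarrow> 'v"
  assumes mean_noise: "(\<Sum>i\<in>UNIV. p i *\<^sub>R w i) = 0"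
begin

private abbreviation v :: "(nat \<Rightarrow> 'n) \<Rightarrow> nat \<Rightarrow> 'v" where
  "v idx s \<equiv> affine_iterate P \<mu> w 0 idx s"

private lemma dep_v: "depends_below s (\<lambda>idx. v idx s)"
  by (rule depends_below_affine_iterate)

text \<open>Given the first \<open>s\<close> indices, the noise of the step averages to zero and
  each \<open>P i\<close> passes to \<open>y\<close> by symmetry. The test vector may itself be
  random, provided it does not see index number \<open>s\<close>.\<close>

lemma expect_inner_step:
  assumes y: "depends_below s y"
  shows "expect (\<lambda>idx. y idx \<bullet> v idx (Suc s)) = expect (\<lambda>idx. mean_map (y idx) \<bullet> v idx s)"
proof -
  have "expect (\<lambda>idx. y idx \<bullet> v idx (Suc s))
      = expect (\<lambda>idx. \<Sum>i\<in>UNIV. p i * (y idx \<bullet> (\<mu> *\<^sub>R P i (v idx s) + w i)))"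
    unfolding affine_iterate.simps
    by (rule expect_fresh_index[of s "\<lambda>i idx. y idx \<bullet> (\<mu> *\<^sub>R P i (v idx s) + w i)"])
       (rule depends_below_comp2[OF y dep_v])
  also have "(\<lambda>idx. \<Sum>i\<in>UNIV. p i * (y idx \<bullet> (\<mu> *\<^sub>R P i (v idx s) + w i)))
      = (\<lambda>idx. mean_map (y idx) \<bullet> v idx s)"
  proof
    fix idx
    have "(\<Sum>i\<in>UNIV. p i * (y idx \<bullet> (\<mu> *\<^sub>R P i (v idx s) + w i)))
        = (\<Sum>i\<in>UNIV. \<mu> * (p i * (P i (y idx) \<bullet> v idx s)) + y idx \<bullet> (p i *\<^sub>R w i))"
      by (simp add: inner_add_right symmetric_P algebra_simps)
    also have "\<dots> = mean_map (y idx) \<bullet> v idx s + y idx \<bullet> (\<Sum>i\<in>UNIV. p i *\<^sub>R w i)"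
      by (simp add: sum.distrib mean_map_def inner_sum_left inner_sum_right sum_distrib_left)
    finally show "(\<Sum>i\<in>UNIV. p i * (y idx \<bullet> (\<mu> *\<^sub>R P i (v idx s) + w i))) = mean_map (y idx) \<bullet> v idx s"
      by (simp add: mean_noise)
  qed
  finally show ?thesis .
qed

text \<open>The last step is peeled off each time; applying \<open>mean_map\<close> to the test
  vector adds no dependence on new indices.\<close>

lemma expect_inner_later:
  assumes "depends_below s y"
  shows "expect (\<lambda>idx. y idx \<bullet> v idx (s + k)) = expect (\<lambda>idx. (mean_map ^^ k) (y idx) \<bullet> v idx s)"
  using assms
proof (induction k arbitrary: y)
  case (Suc k)
  have "expect (\<lambda>idx. y idx \<bullet> v idx (s + Suc k)) = expect (\<lambda>idx. mean_map (y idx) \<bullet> v idx (s + k))"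
    unfolding add_Suc_right by (rule expect_inner_step[OF depends_below_mono[OF Suc.prems]]) simp
  also have "\<dots> = expect (\<lambda>idx. (mean_map ^^ k) (mean_map (y idx)) \<bullet> v idx s)"
    by (rule Suc.IH[OF depends_below_comp[OF Suc.prems]])
  finally show ?case by (simp add: funpow_swap1)
qed simp

text \<open>A weak form of \<open>v\<close> having mean zero: going back to time 0 leaves the inner
  product with the start vector 0.\<close>

lemma expect_inner_const: "expect (\<lambda>idx. c \<bullet> v idx s) = 0"
  using expect_inner_later[of 0 "\<lambda>_. c" s] by (simp add: depends_below_const expect_const)

text \<open>Pulling the later vector back by \<open>k\<close> steps puts
  \<open>mean_map ^^ k\<close> on the earlier one; Cauchy-Schwarz does the rest.\<close>

lemma expect_autocorrelation:
  "expect (\<lambda>idx. v idx s \<bullet> v idx (s + k)) \<le> \<mu> ^ k * expect (\<lambda>idx. (norm (v idx s))\<^sup>2)"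
proof -
  have "expect (\<lambda>idx. v idx s \<bullet> v idx (s + k)) = expect (\<lambda>idx. (mean_map ^^ k) (v idx s) \<bullet> v idx s)"
    by (rule expect_inner_later[OF dep_v])
  also have "\<dots> \<le> expect (\<lambda>idx. \<mu> ^ k * (norm (v idx s))\<^sup>2)"
  proof (rule expect_mono[of s])
    fix idx
    have "(mean_map ^^ k) (v idx s) \<bullet> v idx s \<le> norm ((mean_map ^^ k) (v idx s)) * norm (v idx s)"
      by (rule norm_cauchy_schwarz)
    also have "\<dots> \<le> \<mu> ^ k * norm (v idx s) * norm (v idx s)"
      by (intro mult_right_mono norm_mean_map_power) simp
    finally show "(mean_map ^^ k) (v idx s) \<bullet> v idx s \<le> \<mu> ^ k * (norm (v idx s))\<^sup>2"
      by (simp add: power2_eq_square mult.assoc)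
  qed (rule depends_below_comp[OF dep_v])+
  finally show ?thesis by (simp add: expect_cmult)
qed

text \<open>The second moments satisfy r' \<le> \<mu>^2 r + \<open>?W\<close>, and the bound is the
  fixed point of this recursion.\<close>

lemma expect_norm_sq_noise:
  "expect (\<lambda>idx. (norm (v idx s))\<^sup>2) \<le> (\<Sum>i\<in>UNIV. p i * (norm (w i))\<^sup>2) / (1 - \<mu>\<^sup>2)"
proof (induction s)
  let ?W = "\<Sum>i\<in>UNIV. p i * (norm (w i))\<^sup>2"
  have mu2: "\<mu>\<^sup>2 < 1" using mu_nonneg mu_less_1 by (simp add: power_less_one_iff abs_square_less_1)
  {
    case 0
    have "0 \<le> ?W" by (intro sum_nonneg mult_nonneg_nonneg p_nonneg) simp
    then show ?case using mu2 by (simp add: expect_const)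
  next
    case (Suc s)
    \<comment> \<open>Symmetry turns the cross term of contraction and noise into an inner product
      of \<open>v idx s\<close> with \<open>P i (w i)\<close>. Averaging over \<open>i\<close>
      leaves the deterministic vector \<open>c\<close>, whose inner product with \<open>v\<close>
      has mean zero.\<close>
    define c where "c = (\<Sum>i\<in>UNIV. p i *\<^sub>R (2 * \<mu>) *\<^sub>R P i (w i))"
    have "expect (\<lambda>idx. (norm (v idx (Suc s)))\<^sup>2)
        = expect (\<lambda>idx. \<Sum>i\<in>UNIV. p i * (norm (\<mu> *\<^sub>R P i (v idx s) + w i))\<^sup>2)"
      unfolding affine_iterate.simps
      by (rule expect_fresh_index[of s "\<lambda>i idx. (norm (\<mu> *\<^sub>R P i (v idx s) + w i))\<^sup>2"])
         (rule depends_below_comp[OF dep_v])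
    also have "\<dots> \<le> expect (\<lambda>idx. (\<mu>\<^sup>2 * (norm (v idx s))\<^sup>2 + ?W) + c \<bullet> v idx s)"
    proof (rule expect_mono[of s])
      fix idx
      have "(norm (\<mu> *\<^sub>R P i (v idx s) + w i))\<^sup>2
          \<le> \<mu>\<^sup>2 * (norm (v idx s))\<^sup>2 + (norm (w i))\<^sup>2 + ((2 * \<mu>) *\<^sub>R P i (w i)) \<bullet> v idx s" for i
      proof -
        have "(norm (\<mu> *\<^sub>R P i (v idx s) + w i))\<^sup>2
            = \<mu>\<^sup>2 * (norm (P i (v idx s)))\<^sup>2 + (norm (w i))\<^sup>2 + 2 * \<mu> * (P i (v idx s) \<bullet> w i)"
          unfolding power2_norm_eq_inner
          by (simp add: inner_add_left inner_add_right inner_commute power2_eq_square)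
        moreover have "\<mu>\<^sup>2 * (norm (P i (v idx s)))\<^sup>2 \<le> \<mu>\<^sup>2 * (norm (v idx s))\<^sup>2"
          by (intro mult_left_mono power_mono contraction_P) auto
        moreover have "P i (v idx s) \<bullet> w i = P i (w i) \<bullet> v idx s"
          by (metis symmetric_P inner_commute)
        ultimately show ?thesis by simp
      qed
      then have "(\<Sum>i\<in>UNIV. p i * (norm (\<mu> *\<^sub>R P i (v idx s) + w i))\<^sup>2)
          \<le> (\<Sum>i\<in>UNIV. p i * (\<mu>\<^sup>2 * (norm (v idx s))\<^sup>2 + (norm (w i))\<^sup>2 + ((2 * \<mu>) *\<^sub>R P i (w i)) \<bullet> v idx s))"
        by (intro sum_mono mult_left_mono p_nonneg)
      also have "\<dots> = (\<mu>\<^sup>2 * (norm (v idx s))\<^sup>2 + ?W) + c \<bullet> v idx s"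
        unfolding c_def inner_sum_left
        by (simp add: distrib_left sum.distrib sum_distrib_right[symmetric] sum_p mult.assoc)
      finally show "(\<Sum>i\<in>UNIV. p i * (norm (\<mu> *\<^sub>R P i (v idx s) + w i))\<^sup>2) \<le> \<dots>" .
    qed (rule depends_below_comp[OF dep_v])+
    also have "\<dots> = expect (\<lambda>idx. \<mu>\<^sup>2 * (norm (v idx s))\<^sup>2 + ?W) + expect (\<lambda>idx. c \<bullet> v idx s)"
      by (rule expect_add[of s]; rule depends_below_comp[OF dep_v])
    also have "\<dots> = \<mu>\<^sup>2 * expect (\<lambda>idx. (norm (v idx s))\<^sup>2) + ?W"
      by (subst expect_add[of s]; (rule depends_below_comp[OF dep_v] depends_below_const)?)
         (simp add: expect_inner_const expect_cmult expect_const)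
    also have "\<dots> \<le> \<mu>\<^sup>2 * (?W / (1 - \<mu>\<^sup>2)) + ?W"
      by (intro add_right_mono mult_left_mono Suc) simp
    also have "\<dots> = ?W / (1 - \<mu>\<^sup>2)" using mu2 by (simp add: field_simps)
    finally show ?case .
  }
qed

text \<open>Extending the window by one term adds its second moment, at most \<open>V\<close>, and
  twice its correlation with the earlier terms. Geometric decay bounds this increment independently
  of \<open>k\<close>, so growth is linear.\<close>

lemma expect_norm_sq_sum_noise:
  "expect (\<lambda>idx. (norm (\<Sum>s = m..<m + k. v idx s))\<^sup>2)
    \<le> real k * ((\<Sum>i\<in>UNIV. p i * (norm (w i))\<^sup>2) / (1 - \<mu>)\<^sup>2)"
proof (induction k)
  case 0
  then show ?case by (simp add: expect_const)
next
  case (Suc k)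
  let ?W = "\<Sum>i\<in>UNIV. p i * (norm (w i))\<^sup>2"
  define V where "V = ?W / (1 - \<mu>\<^sup>2)"
  have W: "0 \<le> ?W" by (intro sum_nonneg mult_nonneg_nonneg p_nonneg) simp
  have mu2: "\<mu>\<^sup>2 < 1" using mu_nonneg mu_less_1 by (simp add: power_less_one_iff abs_square_less_1)
  have V: "0 \<le> V" "expect (\<lambda>idx. (norm (v idx s))\<^sup>2) \<le> V" for s
    unfolding V_def using W mu2 by (simp_all add: expect_norm_sq_noise)
  have dep: "depends_below (m + k) (\<lambda>idx. v idx s)" if "s \<le> m + k" for s
    using dep_v that by (rule depends_below_mono)
  have dep_sum: "depends_below (m + k) (\<lambda>idx. \<Sum>s = m..<m + k. v idx s)"
    unfolding depends_below_def
    using dep unfolding depends_below_def by (intro allI impI sum.cong) auto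
  have cross: "expect (\<lambda>idx. (\<Sum>s = m..<m + k. v idx s) \<bullet> v idx (m + k)) \<le> \<mu> / (1 - \<mu>) * V"
  proof -
    have "expect (\<lambda>idx. (\<Sum>s = m..<m + k. v idx s) \<bullet> v idx (m + k))
        = (\<Sum>s = m..<m + k. expect (\<lambda>idx. v idx s \<bullet> v idx (m + k)))"
      unfolding inner_sum_left
      by (rule expect_sum[of _ "m + k"]) (rule depends_below_comp2[OF dep dep]; simp)
    also have "\<dots> \<le> (\<Sum>s = m..<m + k. \<mu> ^ (m + k - s) * V)"
    proof (rule sum_mono)
      fix s assume s: "s \<in> {m..<m + k}"
      have "expect (\<lambda>idx. v idx s \<bullet> v idx (s + (m + k - s)))
          \<le> \<mu> ^ (m + k - s) * expect (\<lambda>idx. (norm (v idx s))\<^sup>2)"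
        by (rule expect_autocorrelation)
      also have "\<dots> \<le> \<mu> ^ (m + k - s) * V" by (intro mult_left_mono V) (simp add: mu_nonneg)
      finally show "expect (\<lambda>idx. v idx s \<bullet> v idx (m + k)) \<le> \<mu> ^ (m + k - s) * V" using s by simp
    qed
    \<comment> \<open>Reindexing by the lag, which runs from 1 to \<open>k\<close>; hence the
      leading factor \<mu> in the geometric sum.\<close>
    also have "\<dots> = (\<Sum>j<k. \<mu> ^ Suc j) * V"
      unfolding sum_distrib_right
      by (rule sum.reindex_bij_witness[of _ "\<lambda>j. m + k - Suc j" "\<lambda>s. m + k - Suc s"])
         (auto simp: Suc_diff_Suc)
    also have "\<dots> \<le> \<mu> / (1 - \<mu>) * V"
    proof (intro mult_right_mono V)
      have "(\<Sum>j<k. \<mu> ^ Suc j) = \<mu> * ((1 - \<mu> ^ k) / (1 - \<mu>))"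
        using mu_less_1 by (simp add: sum_distrib_left[symmetric] sum_gp_strict)
      also have "\<dots> \<le> \<mu> * (1 / (1 - \<mu>))"
        using mu_nonneg mu_less_1 by (intro mult_left_mono divide_right_mono) auto
      finally show "(\<Sum>j<k. \<mu> ^ Suc j) \<le> \<mu> / (1 - \<mu>)" by simp
    qed
    finally show ?thesis .
  qed
  let ?S = "\<lambda>idx. \<Sum>s = m..<m + k. v idx s"
  have "expect (\<lambda>idx. (norm (\<Sum>s = m..<m + Suc k. v idx s))\<^sup>2)
      = expect (\<lambda>idx. ((norm (?S idx))\<^sup>2 + 2 * (?S idx \<bullet> v idx (m + k))) + (norm (v idx (m + k)))\<^sup>2)"
    unfolding power2_norm_eq_inner
    by (intro arg_cong[of _ _ expect] ext) (simp add: inner_add_left inner_add_right inner_commute)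
  also have "\<dots> = expect (\<lambda>idx. (norm (?S idx))\<^sup>2 + 2 * (?S idx \<bullet> v idx (m + k)))
      + expect (\<lambda>idx. (norm (v idx (m + k)))\<^sup>2)"
    by (intro expect_add[of "m + k"] depends_below_comp2[OF dep_sum dep_v] depends_below_comp[OF dep_v])
  also have "\<dots> = expect (\<lambda>idx. (norm (?S idx))\<^sup>2) + expect (\<lambda>idx. 2 * (?S idx \<bullet> v idx (m + k)))
      + expect (\<lambda>idx. (norm (v idx (m + k)))\<^sup>2)"
    by (intro arg_cong2[of _ _ _ _ "(+)"] refl expect_add[of "m + k"]
        depends_below_comp2[OF dep_sum dep_v] depends_below_comp[OF dep_sum])
  also have "\<dots> \<le> real k * (?W / (1 - \<mu>)\<^sup>2) + 2 * (\<mu> / (1 - \<mu>) * V) + V"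
    unfolding expect_cmult by (intro add_mono mult_left_mono Suc cross V) simp
  also have "\<dots> = real k * (?W / (1 - \<mu>)\<^sup>2) + ?W / (1 - \<mu>)\<^sup>2"
  proof -
    \<comment> \<open>The numerator 1 + \<mu> cancels against the same factor of
      \<open>1 - \<mu>\<^sup>2\<close> in the denominator of \<open>V\<close>.\<close>
    have "2 * (\<mu> / (1 - \<mu>) * V) + V = V * ((1 + \<mu>) / (1 - \<mu>))"
      using mu_less_1 by (simp add: field_simps)
    moreover have "1 - \<mu>\<^sup>2 = (1 + \<mu>) * (1 - \<mu>)" by (simp add: power2_eq_square algebra_simps)
    then have "V * ((1 + \<mu>) / (1 - \<mu>)) = ?W / (1 - \<mu>)\<^sup>2"
      using mu_nonneg by (simp add: V_def power2_eq_square)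
    ultimately show ?thesis by linarith
  qed
  finally show ?case by (simp add: distrib_right add_divide_distrib add.commute)
qed

end

end

subsection \<open>Kaczmarz steps\<close>

text \<open>For a zero row the quotient is 0, so the map is the identity.\<close>

definition row_project :: "real^'d^'n \<Rightarrow> 'n \<Rightarrow> real^'d \<Rightarrow> real^'d" where
  "row_project A i x = x - ((row i A \<bullet> x) / (norm (row i A))\<^sup>2) *\<^sub>R row i A"

lemma linear_row_project: "linear (row_project A i)"
  by (rule linearI)
     (simp_all add: row_project_def inner_add_right add_divide_distrib scaleR_add_left algebra_simps)

lemma row_project_symmetric: "row_project A i x \<bullet> y = x \<bullet> row_project A i y"
  by (simp add: row_project_def inner_diff_left inner_diff_right inner_commute)

text \<open>Pythagoras for the component along the row; for a zero row the subtracted quotient is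
  0.\<close>

lemma norm_sq_row_project:
  "(norm (row_project A i x))\<^sup>2 = (norm x)\<^sup>2 - (row i A \<bullet> x)\<^sup>2 / (norm (row i A))\<^sup>2"
proof (cases "row i A = 0")
  case False
  let ?a = "row i A"
  define c where "c = (?a \<bullet> x) / (norm ?a)\<^sup>2"
  have "(norm (row_project A i x))\<^sup>2 = x \<bullet> x - 2 * (c * (?a \<bullet> x)) + c * (c * (?a \<bullet> ?a))"
  proof -
    have "row_project A i x = x - c *\<^sub>R ?a" by (simp add: row_project_def c_def)
    then show ?thesis unfolding power2_norm_eq_inner
      by (simp add: inner_diff_left inner_diff_right inner_commute)
  qed
  moreover have "c * (?a \<bullet> ?a) = ?a \<bullet> x"
    using False by (simp add: c_def power2_norm_eq_inner)
  moreover have "c * (?a \<bullet> x) = (?a \<bullet> x)\<^sup>2 / (norm ?a)\<^sup>2"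
    by (simp add: c_def power2_eq_square[of "?a \<bullet> x"])
  ultimately show ?thesis unfolding power2_norm_eq_inner[of x] by simp
qed (simp add: row_project_def)

lemma norm_row_project_le: "norm (row_project A i x) \<le> norm x"
  by (rule power2_le_imp_le) (simp_all add: norm_sq_row_project)

lemma transpose_mult_eq_sum_rows:
  fixes A :: "real^'d^'n"
  shows "transpose A *v y = (\<Sum>i\<in>UNIV. y $ i *\<^sub>R row i A)"
  by (simp add: matrix_vector_mult_def transpose_def row_def vec_eq_iff mult.commute)

lemma row_in_row_space:
  fixes A :: "real^'d^'n"
  shows "row i A \<in> range (\<lambda>y. transpose A *v y)"
proof -
  have "row i A = transpose A *v axis i 1"
    by (simp only: matrix_vector_mult_basis column_transpose)
  then show ?thesis by blast
qed

lemma row_project_in_row_space: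
  assumes "x \<in> range (\<lambda>y. transpose A *v y)"
  shows "row_project A i x \<in> range (\<lambda>y. transpose A *v y)"
  unfolding row_project_def
  by (intro subspace_diff[OF subspace_row_space] subspace_scale[OF subspace_row_space]
      row_in_row_space assms)

text \<open>A Kaczmarz step is affine with linear part \<open>row_project\<close>, so the error
  relative to any point \<open>x\<close> follows the recursion, with noise equal to the displacement
  of \<open>x\<close> under one full step.\<close>

lemma rk_rr_error:
  "rk_rr A b \<mu> x0 idx s - x
    = affine_iterate (row_project A) \<mu> (\<lambda>i. \<mu> *\<^sub>R kaczmarz_step A b i x - x) (x0 - x) idx s"
proof (induction s)
  case (Suc s)
  let ?y = "rk_rr A b \<mu> x0 idx s"
  have "kaczmarz_step A b (idx s) ?y = row_project A (idx s) (?y - x) + kaczmarz_step A b (idx s) x"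
    by (simp add: kaczmarz_step_def row_project_def inner_diff_right diff_divide_distrib algebra_simps)
  then show ?case by (simp add: Suc[symmetric] scaleR_add_right)
qed simp

text \<open>The sampling weights cancel the row norms in the Pythagorean loss, so the losses add up
  to the squared norm of \<open>A *v x\<close>.\<close>

lemma sum_project_norm_sq:
  fixes A :: "real^'d^'n"
  assumes "A \<noteq> 0"
  shows "(\<Sum>i\<in>UNIV. (norm (row i A))\<^sup>2 / (frobenius_norm A)\<^sup>2 * (norm (row_project A i x))\<^sup>2)
    = (norm x)\<^sup>2 - (norm (A *v x))\<^sup>2 / (frobenius_norm A)\<^sup>2"
proof -
  let ?F = "(frobenius_norm A)\<^sup>2"
  have F: "?F > 0" using frobenius_norm_pos[OF assms] by simp
  have "(norm (row i A))\<^sup>2 / ?F * (norm (row_project A i x))\<^sup>2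
      = ((norm (row i A))\<^sup>2 * (norm x)\<^sup>2 - ((A *v x) $ i)\<^sup>2) / ?F" for i
    by (cases "row i A = 0") (simp_all add: norm_sq_row_project row_inner_eq[symmetric] right_diff_distrib diff_divide_distrib)
  then have "(\<Sum>i\<in>UNIV. (norm (row i A))\<^sup>2 / ?F * (norm (row_project A i x))\<^sup>2)
      = (\<Sum>i\<in>UNIV. ((norm (row i A))\<^sup>2 * (norm x)\<^sup>2 - ((A *v x) $ i)\<^sup>2)) / ?F"
    by (simp only: sum_divide_distrib)
  also have "\<dots> = (?F * (norm x)\<^sup>2 - (norm (A *v x))\<^sup>2) / ?F"
    by (simp add: sum_subtractf sum_distrib_right[symmetric] frobenius_norm_sq power2_norm_vec[of "A *v x"])
  also have "\<dots> = (norm x)\<^sup>2 - (norm (A *v x))\<^sup>2 / ?F"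
    using F by (simp add: diff_divide_distrib)
  finally show ?thesis .
qed

lemma sum_project_norm_sq_le:
  fixes A :: "real^'d^'n"
  assumes "A \<noteq> 0" "x \<in> range (\<lambda>y. transpose A *v y)"
  shows "(\<Sum>i\<in>UNIV. (norm (row i A))\<^sup>2 / (frobenius_norm A)\<^sup>2 * (norm (row_project A i x))\<^sup>2)
    \<le> (1 - 1 / (demmel_cond A)\<^sup>2) * (norm x)\<^sup>2"
  using norm_sq_row_space_le[OF assms] unfolding sum_project_norm_sq[OF assms(1)]
  by (simp add: left_diff_distrib)

text \<open>Shifted by \<open>y\<close>, the noise is a multiple of the sampled row, and
  \<open>normal\<close> says that its mean is \<open>y\<close>. The second moment of
  \<open>w\<close> is therefore a variance, at most the second moment of the shifted noise.\<close>

lemma kaczmarz_noise: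
  fixes A :: "real^'d^'n" and x :: "real^'d"
  assumes A: "A \<noteq> 0" and normal: "\<mu> *\<^sub>R (transpose A *v (b - A *v x)) = ((1 - \<mu>) * (frobenius_norm A)\<^sup>2) *\<^sub>R x"
  defines "p \<equiv> \<lambda>i. (norm (row i A))\<^sup>2 / (frobenius_norm A)\<^sup>2"
    and "w \<equiv> \<lambda>i. \<mu> *\<^sub>R kaczmarz_step A b i x - x"
  shows "(\<Sum>i\<in>UNIV. p i *\<^sub>R w i) = 0"
    and "(\<Sum>i\<in>UNIV. p i * (norm (w i))\<^sup>2) \<le> \<mu>\<^sup>2 * (norm (b - A *v x))\<^sup>2 / (frobenius_norm A)\<^sup>2"
proof -
  let ?F = "(frobenius_norm A)\<^sup>2"
  define r where "r = b - A *v x"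
  define y where "y = (1 - \<mu>) *\<^sub>R x"
  have F: "?F > 0" using frobenius_norm_pos[OF A] by simp
  have sum_p: "(\<Sum>i\<in>UNIV. p i) = 1"
    using F by (simp add: p_def sum_divide_distrib[symmetric] frobenius_norm_sq)
  have w: "w i + y = (\<mu> * (r $ i / (norm (row i A))\<^sup>2)) *\<^sub>R row i A" for i
    by (simp add: w_def y_def r_def kaczmarz_step_def row_inner_eq algebra_simps)
  have "p i *\<^sub>R (w i + y) = (\<mu> / ?F) *\<^sub>R (r $ i *\<^sub>R row i A)" for i
    unfolding w by (cases "row i A = 0") (simp_all add: p_def)
  then have "(\<Sum>i\<in>UNIV. p i *\<^sub>R (w i + y)) = (1 / ?F) *\<^sub>R (\<mu> *\<^sub>R (transpose A *v r))"
    by (simp only: transpose_mult_eq_sum_rows scaleR_sum_right[symmetric]) simp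
  also have "\<dots> = y" unfolding r_def normal y_def using F by simp
  finally have mean: "(\<Sum>i\<in>UNIV. p i *\<^sub>R w i) + y = y"
    by (simp add: scaleR_add_right sum.distrib scaleR_sum_left[symmetric] sum_p)
  then show zero: "(\<Sum>i\<in>UNIV. p i *\<^sub>R w i) = 0" by simp
  have "p i * (norm (w i + y))\<^sup>2 = p i * (norm (w i))\<^sup>2 + 2 * ((p i *\<^sub>R w i) \<bullet> y) + p i * (norm y)\<^sup>2" for i
    unfolding power2_norm_eq_inner by (simp add: inner_add_left inner_add_right inner_commute algebra_simps)
  then have "(\<Sum>i\<in>UNIV. p i * (norm (w i + y))\<^sup>2)
      = (\<Sum>i\<in>UNIV. p i * (norm (w i))\<^sup>2) + 2 * ((\<Sum>i\<in>UNIV. p i *\<^sub>R w i) \<bullet> y) + (norm y)\<^sup>2"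
    by (simp only: sum.distrib sum_distrib_left[symmetric] sum_distrib_right[symmetric]
        inner_sum_left[symmetric] sum_p mult_1)
  then have "(\<Sum>i\<in>UNIV. p i * (norm (w i))\<^sup>2) \<le> (\<Sum>i\<in>UNIV. p i * (norm (w i + y))\<^sup>2)"
    unfolding zero by simp
  also have "\<dots> \<le> (\<Sum>i\<in>UNIV. \<mu>\<^sup>2 * (r $ i)\<^sup>2 / ?F)"
  proof (rule sum_mono)
    fix i
    show "p i * (norm (w i + y))\<^sup>2 \<le> \<mu>\<^sup>2 * (r $ i)\<^sup>2 / ?F"
    \<comment> \<open>A zero row has weight 0 but may have a nonzero residual entry, which is why
      only an inequality holds.\<close>
    proof (cases "row i A = 0")
      case False
      then have "p i * (norm (w i + y))\<^sup>2 = \<mu>\<^sup>2 * (r $ i)\<^sup>2 / ?F"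
        unfolding w p_def
        by (simp add: power_mult_distrib power_divide) (simp add: power2_eq_square power4_eq_xxxx)
      then show ?thesis by simp
    qed (simp add: p_def)
  qed
  also have "\<dots> = \<mu>\<^sup>2 * (norm r)\<^sup>2 / ?F"
    by (simp add: power2_norm_vec[of r] sum_distrib_left sum_divide_distrib)
  finally show "(\<Sum>i\<in>UNIV. p i * (norm (w i))\<^sup>2) \<le> \<mu>\<^sup>2 * (norm (b - A *v x))\<^sup>2 / ?F"
    by (simp add: r_def)
qed

section \<open>Second moment of a tail average\<close>

lemma norm_sq_sum_le:
  fixes f :: "'a \<Rightarrow> 'b::real_inner"
  shows "(norm (\<Sum>s\<in>S. f s))\<^sup>2 \<le> real (card S) * (\<Sum>s\<in>S. (norm (f s))\<^sup>2)"
proof -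
  have "(norm (\<Sum>s\<in>S. f s))\<^sup>2 \<le> (\<Sum>s\<in>S. norm (f s))\<^sup>2"
    by (intro power_mono norm_sum) simp
  also have "\<dots> \<le> (\<Sum>s\<in>S. (norm (f s))\<^sup>2) * (\<Sum>s\<in>S. 1\<^sup>2)"
    using Cauchy_Schwarz_ineq_sum[of "\<lambda>s. norm (f s)" "\<lambda>_. 1" S] by simp
  finally show ?thesis by (simp add: mult.commute)
qed

text \<open>The parallelogram law. Splitting the error with it produces both factors 2 in the final
  bound.\<close>

lemma norm_sq_add_le: "(norm (x + y))\<^sup>2 \<le> 2 * (norm x)\<^sup>2 + 2 * (norm (y :: 'b::real_inner))\<^sup>2"
proof -
  have "(norm (x + y))\<^sup>2 + (norm (x - y))\<^sup>2 = 2 * (norm x)\<^sup>2 + 2 * (norm y)\<^sup>2"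
    unfolding power2_norm_eq_inner by (simp add: inner_add_left inner_add_right inner_diff_left inner_diff_right)
  then show ?thesis by (smt (verit) zero_le_power2)
qed

context symmetric_contractions
begin

lemma expect_norm_sq_average:
  assumes S: "subspace S" "\<And>i x. x \<in> S \<Longrightarrow> P i x \<in> S" and z: "z \<in> S"
    and decay: "\<And>x. x \<in> S \<Longrightarrow> (\<Sum>i\<in>UNIV. p i * (norm (P i x))\<^sup>2) \<le> q * (norm x)\<^sup>2"
    and q: "0 \<le> q" "q \<le> 1"
    and w: "(\<Sum>i\<in>UNIV. p i *\<^sub>R w i) = 0"
    and tb: "tb < t"
  shows "expect (\<lambda>idx. (norm ((1 / real (t - tb)) *\<^sub>R (\<Sum>s = tb..<t. affine_iterate P \<mu> w z idx s)))\<^sup>2)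
    \<le> 2 * (\<mu>\<^sup>2 * q) ^ tb * (norm z)\<^sup>2
      + 2 * ((\<Sum>i\<in>UNIV. p i * (norm (w i))\<^sup>2) / (1 - \<mu>)\<^sup>2) / real (t - tb)"
proof -
  let ?u = "\<lambda>idx. affine_iterate P \<mu> (\<lambda>_. 0) z idx" and ?v = "\<lambda>idx. affine_iterate P \<mu> w 0 idx"
  let ?W = "\<Sum>i\<in>UNIV. p i * (norm (w i))\<^sup>2"
  define n where "n = real (t - tb)"
  have n: "n > 0" using tb by (simp add: n_def)
  have r: "0 \<le> \<mu>\<^sup>2 * q" "\<mu>\<^sup>2 * q \<le> 1"
    using q mu_nonneg mu_less_1 by (auto intro!: mult_le_one power_le_one)
  have dep: "depends_below t (\<lambda>idx. affine_iterate P \<mu> w' z' idx s)" if "s < t" for w' z' s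
    by (rule depends_below_mono[OF depends_below_affine_iterate]) (use that in simp)
  have dep_sum: "depends_below t (\<lambda>idx. \<Sum>s = tb..<t. affine_iterate P \<mu> w' z' idx s)" for w' z'
    unfolding depends_below_def
    using dep unfolding depends_below_def by (intro allI impI sum.cong) auto
  have dep_sq: "depends_below t (\<lambda>idx. \<Sum>s = tb..<t. (norm (?u idx s))\<^sup>2)"
    unfolding depends_below_def
    using dep unfolding depends_below_def by (intro allI impI sum.cong arg_cong[of _ _ "\<lambda>x. (norm x)\<^sup>2"]) auto
  have "expect (\<lambda>idx. (norm ((1 / n) *\<^sub>R (\<Sum>s = tb..<t. affine_iterate P \<mu> w z idx s)))\<^sup>2)
      \<le> expect (\<lambda>idx. 2 / n * (\<Sum>s = tb..<t. (norm (?u idx s))\<^sup>2)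
          + 2 / n\<^sup>2 * (norm (\<Sum>s = tb..<t. ?v idx s))\<^sup>2)"
  proof (rule expect_mono[of t])
    fix idx
    have "(\<Sum>s = tb..<t. affine_iterate P \<mu> w z idx s) = (\<Sum>s = tb..<t. ?u idx s) + (\<Sum>s = tb..<t. ?v idx s)"
      by (subst affine_iterate_split[OF linear_P]) (rule sum.distrib)
    then have "(norm (\<Sum>s = tb..<t. affine_iterate P \<mu> w z idx s))\<^sup>2
        \<le> 2 * (norm (\<Sum>s = tb..<t. ?u idx s))\<^sup>2 + 2 * (norm (\<Sum>s = tb..<t. ?v idx s))\<^sup>2"
      using norm_sq_add_le by simp
    \<comment> \<open>For the noiseless part Cauchy-Schwarz suffices: its factor \<open>n\<close>
      turns the prefactor into a plain average of second moments.\<close>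
    also have "\<dots> \<le> 2 * (n * (\<Sum>s = tb..<t. (norm (?u idx s))\<^sup>2)) + 2 * (norm (\<Sum>s = tb..<t. ?v idx s))\<^sup>2"
      using norm_sq_sum_le[of "?u idx" "{tb..<t}"] by (simp add: n_def)
    finally have "(norm (\<Sum>s = tb..<t. affine_iterate P \<mu> w z idx s))\<^sup>2 / n\<^sup>2
        \<le> (2 * (n * (\<Sum>s = tb..<t. (norm (?u idx s))\<^sup>2)) + 2 * (norm (\<Sum>s = tb..<t. ?v idx s))\<^sup>2) / n\<^sup>2"
      by (rule divide_right_mono) simp
    also have "\<dots> = 2 / n * (\<Sum>s = tb..<t. (norm (?u idx s))\<^sup>2) + 2 / n\<^sup>2 * (norm (\<Sum>s = tb..<t. ?v idx s))\<^sup>2"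
      using n by (simp add: add_divide_distrib power2_eq_square)
    finally show "(norm ((1 / n) *\<^sub>R (\<Sum>s = tb..<t. affine_iterate P \<mu> w z idx s)))\<^sup>2 \<le> \<dots>"
      using n by (simp add: power_divide)
  next
    show "depends_below t (\<lambda>idx. (norm ((1 / n) *\<^sub>R (\<Sum>s = tb..<t. affine_iterate P \<mu> w z idx s)))\<^sup>2)"
      by (rule depends_below_comp[OF dep_sum])
    show "depends_below t (\<lambda>idx. 2 / n * (\<Sum>s = tb..<t. (norm (?u idx s))\<^sup>2)
          + 2 / n\<^sup>2 * (norm (\<Sum>s = tb..<t. ?v idx s))\<^sup>2)"
      by (rule depends_below_comp2[OF dep_sq dep_sum])
  qed
  also have "\<dots> = expect (\<lambda>idx. 2 / n * (\<Sum>s = tb..<t. (norm (?u idx s))\<^sup>2))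
      + expect (\<lambda>idx. 2 / n\<^sup>2 * (norm (\<Sum>s = tb..<t. ?v idx s))\<^sup>2)"
    by (rule expect_add[of t]) (rule depends_below_comp[OF dep_sq], rule depends_below_comp[OF dep_sum])
  also have "\<dots> = 2 / n * (\<Sum>s = tb..<t. expect (\<lambda>idx. (norm (?u idx s))\<^sup>2))
      + 2 / n\<^sup>2 * expect (\<lambda>idx. (norm (\<Sum>s = tb..<t. ?v idx s))\<^sup>2)"
  proof -
    have "expect (\<lambda>idx. \<Sum>s = tb..<t. (norm (?u idx s))\<^sup>2)
        = (\<Sum>s = tb..<t. expect (\<lambda>idx. (norm (?u idx s))\<^sup>2))"
      by (rule expect_sum[of _ t]) (rule depends_below_comp[OF dep]; simp)
    then show ?thesis by (simp only: expect_cmult)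
  qed
  \<comment> \<open>The noise sum has second moment of order \<open>n\<close> rather than
    \<open>n\<^sup>2\<close>, which leaves a factor 1/n after averaging.\<close>
  also have "\<dots> \<le> 2 / n * (\<Sum>s = tb..<t. (\<mu>\<^sup>2 * q) ^ tb * (norm z)\<^sup>2)
      + 2 / n\<^sup>2 * (n * (?W / (1 - \<mu>)\<^sup>2))"
  proof (intro add_mono mult_left_mono sum_mono)
    fix s assume s: "s \<in> {tb..<t}"
    have "expect (\<lambda>idx. (norm (?u idx s))\<^sup>2) \<le> (\<mu>\<^sup>2 * q) ^ s * (norm z)\<^sup>2"
      by (rule expect_norm_sq_homogeneous[OF S z decay q(1)])
    \<comment> \<open>The ratio is at most 1, so the start of the window dominates.\<close>
    also have "\<dots> \<le> (\<mu>\<^sup>2 * q) ^ tb * (norm z)\<^sup>2"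
      using s by (intro mult_right_mono power_decreasing r) auto
    finally show "expect (\<lambda>idx. (norm (?u idx s))\<^sup>2) \<le> (\<mu>\<^sup>2 * q) ^ tb * (norm z)\<^sup>2" .
  next
    show "expect (\<lambda>idx. (norm (\<Sum>s = tb..<t. ?v idx s))\<^sup>2) \<le> n * (?W / (1 - \<mu>)\<^sup>2)"
      using expect_norm_sq_sum_noise[OF w, of tb "t - tb"] tb by (simp add: n_def)
  qed (use n in auto)
  also have "\<dots> = 2 * (\<mu>\<^sup>2 * q) ^ tb * (norm z)\<^sup>2 + 2 * (?W / (1 - \<mu>)\<^sup>2) / n"
  proof -
    have const: "(\<Sum>s = tb..<t. (\<mu>\<^sup>2 * q) ^ tb * (norm z)\<^sup>2) = n * ((\<mu>\<^sup>2 * q) ^ tb * (norm z)\<^sup>2)"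
      by (simp add: n_def)
    show ?thesis unfolding const using n
      by (simp add: power2_eq_square[of n] mult.commute)
  qed
  finally show ?thesis unfolding n_def .
qed

end

section \<open>Ridge regression as an instance of symmetric contractions\<close>

theorem theorem5:
  fixes A :: "real^'d^'n" and b :: "real^'n" and \<mu> lam :: real
    and x0 x\<mu> :: "real^'d" and tb t :: nat
    and M :: "'w measure" and I :: "nat \<Rightarrow> 'w \<Rightarrow> 'n"
  assumes "A \<noteq> 0" and "CARD('n) > CARD('d)"
    and "0 < \<mu>" and "\<mu> < 1"
    and "lam = (1 - \<mu>) / \<mu> * (frobenius_norm A)\<^sup>2"
    and "x\<mu> = ridge_solution A b lam"
    and "x0 \<in> range (\<lambda>y. transpose A *v y)"
    and "tb < t"
    and "kaczmarz_sampling A M I"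
  shows "(\<integral>\<omega>. (norm (tail_average (rk_rr A b \<mu> x0 (\<lambda>s. I s \<omega>)) tb t - x\<mu>))\<^sup>2 \<partial>M)
     \<le> 2 * (\<mu>\<^sup>2 * (1 - 1 / (demmel_cond A)\<^sup>2)) ^ tb * (norm (x0 - x\<mu>))\<^sup>2
       + 2 * \<mu> / (real (t - tb) * (1 - \<mu>) * lam) * (norm (b - A *v x\<mu>))\<^sup>2"
proof -
  let ?F = "(frobenius_norm A)\<^sup>2" and ?S = "range (\<lambda>y. transpose A *v y)"
  define p where "p = (\<lambda>i. (norm (row i A))\<^sup>2 / ?F)"
  define w where "w = (\<lambda>i. \<mu> *\<^sub>R kaczmarz_step A b i x\<mu> - x\<mu>)"
  define n where "n = real (t - tb)"
  have n: "n > 0" using assms(8) by (simp add: n_def)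
  have F: "?F > 0" using frobenius_norm_pos[OF assms(1)] by simp
  have lam: "lam > 0" using assms(3-5) F by simp
  \<comment> \<open>This link between \<open>lam\<close> and \<mu> matches the ridge normal equation
    to the zero-mean condition for the noise.\<close>
  have mu_lam: "\<mu> * lam = (1 - \<mu>) * ?F" using assms(3,5) by simp
  interpret prob_space M using assms(9) by (simp add: kaczmarz_sampling_def)
  interpret symmetric_contractions M I p "row_project A" \<mu>
    using assms(3,4,9)
    by unfold_locales
       (simp_all add: kaczmarz_sampling_def p_def linear_add[OF linear_row_project]
         linear_scale[OF linear_row_project] row_project_symmetric norm_row_project_le)
  have normal: "transpose A *v (b - A *v x\<mu>) = lam *\<^sub>R x\<mu>"
    unfolding assms(6) by (rule ridge_normal_equation[OF lam])
  \<comment> \<open>Dividing the normal equation by \<open>lam\<close> exhibits the ridge solution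
    as a row-space vector; the initial error then lies there too.\<close>
  have "x\<mu> = transpose A *v ((1 / lam) *\<^sub>R (b - A *v x\<mu>))"
    using lam by (simp only: matrix_vector_mult_scaleR normal) simp
  then have "x\<mu> \<in> ?S" by blast
  then have start: "x0 - x\<mu> \<in> ?S" using assms(7) by (rule_tac subspace_diff[OF subspace_row_space])
  have "\<mu> *\<^sub>R (transpose A *v (b - A *v x\<mu>)) = ((1 - \<mu>) * ?F) *\<^sub>R x\<mu>"
    by (simp only: normal scaleR_scaleR mu_lam)
  from kaczmarz_noise[OF assms(1) this]
  have noise: "(\<Sum>i\<in>UNIV. p i *\<^sub>R w i) = 0"
    "(\<Sum>i\<in>UNIV. p i * (norm (w i))\<^sup>2) \<le> \<mu>\<^sup>2 * (norm (b - A *v x\<mu>))\<^sup>2 / ?F"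
    unfolding p_def w_def .
  have q: "0 \<le> 1 - 1 / (demmel_cond A)\<^sup>2" "1 - 1 / (demmel_cond A)\<^sup>2 \<le> 1"
    using demmel_cond_ge_1[OF assms(1)] by (simp_all add: one_le_power)
  have decay: "(\<Sum>i\<in>UNIV. p i * (norm (row_project A i x))\<^sup>2) \<le> (1 - 1 / (demmel_cond A)\<^sup>2) * (norm x)\<^sup>2"
    if "x \<in> ?S" for x
    unfolding p_def using assms(1) that by (rule sum_project_norm_sq_le)
  \<comment> \<open>The window has \<open>t - tb\<close> terms, so subtracting the ridge solution
    from the average equals averaging the errors.\<close>
  have err: "tail_average (rk_rr A b \<mu> x0 idx) tb t - x\<mu>
      = (1 / real (t - tb)) *\<^sub>R (\<Sum>s = tb..<t. affine_iterate (row_project A) \<mu> w (x0 - x\<mu>) idx s)" for idx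
  proof -
    have "(\<Sum>s = tb..<t. affine_iterate (row_project A) \<mu> w (x0 - x\<mu>) idx s)
        = (\<Sum>s = tb..<t. rk_rr A b \<mu> x0 idx s) - real (t - tb) *\<^sub>R x\<mu>"
      unfolding w_def rk_rr_error[symmetric] by (simp add: sum_subtractf scaleR_conv_of_real sum_constant_scaleR)
    then show ?thesis using assms(8) by (simp add: tail_average_def scaleR_diff_right)
  qed
  have "(\<integral>\<omega>. (norm (tail_average (rk_rr A b \<mu> x0 (\<lambda>s. I s \<omega>)) tb t - x\<mu>))\<^sup>2 \<partial>M)
      = expect (\<lambda>idx. (norm ((1 / real (t - tb)) *\<^sub>R
          (\<Sum>s = tb..<t. affine_iterate (row_project A) \<mu> w (x0 - x\<mu>) idx s)))\<^sup>2)"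
    unfolding expect_def err ..
  also have "\<dots> \<le> 2 * (\<mu>\<^sup>2 * (1 - 1 / (demmel_cond A)\<^sup>2)) ^ tb * (norm (x0 - x\<mu>))\<^sup>2
      + 2 * ((\<Sum>i\<in>UNIV. p i * (norm (w i))\<^sup>2) / (1 - \<mu>)\<^sup>2) / n"
    unfolding n_def
    by (rule expect_norm_sq_average[OF subspace_row_space row_project_in_row_space start decay q noise(1) assms(8)])
  also have "\<dots> \<le> 2 * (\<mu>\<^sup>2 * (1 - 1 / (demmel_cond A)\<^sup>2)) ^ tb * (norm (x0 - x\<mu>))\<^sup>2
      + 2 * ((\<mu>\<^sup>2 * (norm (b - A *v x\<mu>))\<^sup>2 / ?F) / (1 - \<mu>)\<^sup>2) / n"
    using n by (intro add_left_mono divide_right_mono mult_left_mono noise(2)) auto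
  \<comment> \<open>One factor \<mu> / ((1 - \<mu>) \<open>?F\<close>) is 1 /
    \<open>lam\<close>.\<close>
  also have "2 * ((\<mu>\<^sup>2 * (norm (b - A *v x\<mu>))\<^sup>2 / ?F) / (1 - \<mu>)\<^sup>2) / n
      = 2 * \<mu> / (n * (1 - \<mu>) * lam) * (norm (b - A *v x\<mu>))\<^sup>2"
    unfolding assms(5) using F n assms(3,4) by (simp add: power2_eq_square ac_simps)
  finally show ?thesis unfolding n_def .
qed

end
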